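(* For every even integer $q\ge 2$, there exists a code $C'\subseteq B_q^4$ capable of correcting single deletions that is perfect, i.e. $\lfloor C'\rfloor_1=B_q^3$, and optimal, i.e. $|C'|=N(4,q,1)=\dfrac{q^2(q+2)}{4}$.
   Context: $B_q=\{0,\dots,q-1\}$ and $B_q^n$ is the set of words of length $n$ over $B_q$. For a word $x$, $\lfloor x\rfloor_1$ is the set of words obtained from $x$ by deleting one letter, and $\lfloor C\rfloor_1=\bigcup_{x\in C}\lfloor x\rfloor_1$. A code $C\subseteq B_q^4$ is capable of correcting single deletions if the sets $\lfloor x\rfloor_1$ ($x\in C$) are pairwise disjoint; it is perfect if moreover $\lfloor C\rfloor_1=\lfloor B_q^4\rfloor_1=B_q^3$. $N(4,q,1)$ is the maximum cardinality of a code in $B_q^4$ capable of correcting single deletions. *)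

theory Defs
  imports Main
begin

definition words :: "nat \<Rightarrow> nat \<Rightarrow> nat list set" where
  "words q n = {w. length w = n \<and> set w \<subseteq> {..<q}}"

definition del1 :: "nat list \<Rightarrow> nat list set" where
  "del1 x = {take i x @ drop (Suc i) x | i. i < length x}"

definition del1_set :: "nat list set \<Rightarrow> nat list set" where
  "del1_set C = (\<Union>x\<in>C. del1 x)"

definition corrects_single_deletion :: "nat list set \<Rightarrow> bool" where
  "corrects_single_deletion C =
     (\<forall>x\<in>C. \<forall>y\<in>C. x \<noteq> y \<longrightarrow> del1 x \<inter> del1 y = {})"

definition N_del :: "nat \<Rightarrow> nat \<Rightarrow> nat" where
  "N_del n q = Max {card C | C. C \<subseteq> words q n \<and> corrects_single_deletion C}"

end

theory Submission
  imports Defs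
begin

text \<open>
  Write \<open>q = 2h\<close> and take the letters in \<open>\<int>/q\<close>.  A word of length three is then given by its
  first letter and its two consecutive differences \<open>u, v \<in> (-h, h]\<close>.  The translates of
  \<open>0, s, t, s + t\<close> with \<open>0 < t < s < h\<close> or \<open>-h < s < t < 0\<close> cover the differences \<open>(s, t)\<close>,
  \<open>(t, s)\<close>, \<open>(s, t - s)\<close> and \<open>(t - s, s)\<close>, hence all \<open>(u, v)\<close> with \<open>u, v \<notin> {0, h}\<close> and
  \<open>u \<noteq> \<plusminus>v\<close>.  The antipodal map \<open>a \<mapsto> a + h\<close> takes care of the rest: words such as
  \<open>a b (b + h) a\<close> and \<open>a (b + h) b c\<close>, with \<open>b\<close> the midpoint of \<open>a\<close> and \<open>c\<close>, cover the words
  \<open>aba\<close>, the arithmetic progressions and the words with an antipodal step; only the cosets of the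
  subgroup of order four (for even \<open>h\<close>) need a separate code.  The numbers of words obtained by
  deletions add up to at most \<open>q\<^sup>3\<close>, so covering everything forces disjointness.

  For optimality, give \<open>aaa\<close> weight 4, \<open>aab\<close> and \<open>abb\<close> weight 2, \<open>abc\<close> weight 1 and \<open>aba\<close> weight 0.
  Every word of length four other than \<open>abca\<close> receives at least 4 from its deletions, and \<open>abca\<close> receives 2.
\<close>

section \<open>Single deletions and short words\<close>

lemma del1_four:
  "del1 [a, b, c, d] = {[b, c, d], [a, c, d], [a, b, d], [a, b, c]}"
proof -
  have "del1 [a, b, c, d] =
      (\<lambda>i. take i [a, b, c, d] @ drop (Suc i) [a, b, c, d]) ` {..<4}"
    unfolding del1_def by auto
  also have "{..<4} = {0, 1, 2, 3 :: nat}"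
    by auto
  finally show ?thesis
    by (simp add: numeral_2_eq_2 numeral_3_eq_3)
qed

lemma del1_map: "del1 (map f w) = map f ` del1 w"
  unfolding del1_def by (auto simp: take_map drop_map image_iff) (metis map_append)

lemma finite_del1: "finite (del1 w)"
proof -
  have "del1 w = (\<lambda>i. take i w @ drop (Suc i) w) ` {..<length w}"
    unfolding del1_def by auto
  thus ?thesis by simp
qed

lemma del1_words:
  assumes "w \<in> words q (Suc n)" "y \<in> del1 w"
  shows "y \<in> words q n"
  using assms set_take_subset[of _ w] set_drop_subset[of _ w]
  unfolding words_def del1_def by fastforce

lemma finite_words: "finite (words q n)"
  using finite_lists_length_eq[of "{..<q}" n] unfolding words_def by (simp add: conj_commute)

lemma card_words: "card (words q n) = q ^ n"
  using card_lists_length_eq[of "{..<q}" n] unfolding words_def by (simp add: conj_commute)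

lemma words_fourE:
  assumes "w \<in> words q 4"
  obtains a b c d where "w = [a, b, c, d]" "a < q" "b < q" "c < q" "d < q"
proof -
  have "length w = Suc (Suc (Suc (Suc 0)))" "set w \<subseteq> {..<q}"
    using assms by (auto simp: words_def)
  thus ?thesis using that by (auto simp: length_Suc_conv)
qed

lemma words_threeE:
  assumes "w \<in> words q 3"
  obtains a b c where "w = [a, b, c]" "a < q" "b < q" "c < q"
proof -
  have "length w = Suc (Suc (Suc 0))" "set w \<subseteq> {..<q}"
    using assms by (auto simp: words_def)
  thus ?thesis using that by (auto simp: length_Suc_conv)
qed

section \<open>The upper bound\<close>

fun weight :: "nat list \<Rightarrow> nat" where
  "weight [a, b, c] =
     (if a = c then (if b = a then 4 else 0) else if b = a \<or> b = c then 2 else 1)"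
| "weight _ = 0"

text \<open>The exceptional words of the weight argument: deleting an inner letter leaves
  \<open>aba\<close> or \<open>aca\<close>, both of weight 0.\<close>

definition bracket :: "nat list \<Rightarrow> bool" where
  "bracket x \<longleftrightarrow> (\<exists>a b c. x = [a, b, c, a] \<and> a \<noteq> b \<and> a \<noteq> c \<and> b \<noteq> c)"

lemma weight_del1_ge:
  assumes "length x = 4"
  shows "4 \<le> (\<Sum>y\<in>del1 x. weight y) + (if bracket x then 2 else 0)"
proof -
  have "length x = Suc (Suc (Suc (Suc 0)))" using assms by simp
  then obtain a b c d where x: "x = [a, b, c, d]" by (auto simp: length_Suc_conv)
  have br: "bracket x \<longleftrightarrow> a = d \<and> a \<noteq> b \<and> a \<noteq> c \<and> b \<noteq> c"
    unfolding bracket_def x by auto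
  show ?thesis
    unfolding br unfolding x del1_four
    \<comment> \<open>The equality pattern of the four letters fixes all weights and also which
      deletions coincide.\<close>
    by (cases "a = b"; cases "a = c"; cases "a = d"; cases "b = c"; cases "b = d"; cases "c = d";
        simp add: sum.insert_if)
qed

text \<open>Between distinct outer letters each middle letter counts 1, and repeating either
  neighbour adds 1 more.\<close>

lemma sum_weight_middle:
  assumes "a < q" "c < q"
  shows "(\<Sum>b<q. weight [a, b, c]) = (if a = c then 4 else q + 2)"
proof (cases "a = c")
  case True
  have "(\<Sum>b<q. weight [a, b, c]) = (\<Sum>b<q. if b = a then 4 else 0)"
    using True by (intro sum.cong) auto
  thus ?thesis using True assms by simp
next
  case False
  have "(\<Sum>b<q. weight [a, b, c]) =
      (\<Sum>b<q. 1 + ((if b = a then 1 else 0) + (if b = c then 1 else 0)))"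
    using False by (intro sum.cong) auto
  also have "\<dots> = q + 2"
    unfolding sum.distrib using assms by simp
  finally show ?thesis using False by simp
qed

lemma sum_weight_words:
  "(\<Sum>y\<in>words q 3. weight y) = 4 * q + q * (q - 1) * (q + 2)"
proof -
  \<comment> \<open>The middle letter comes last in the triple, so that it is summed innermost with
    both outer letters fixed.\<close>
  have eq: "words q 3 = (\<lambda>(a, c, b). [a, b, c]) ` ({..<q} \<times> {..<q} \<times> {..<q})"
  proof (intro equalityI subsetI)
    fix y assume "y \<in> words q 3"
    then obtain a b c where "y = [a, b, c]" "a < q" "b < q" "c < q" by (rule words_threeE)
    thus "y \<in> (\<lambda>(a, c, b). [a, b, c]) ` ({..<q} \<times> {..<q} \<times> {..<q})"
      by (force intro: image_eqI[where x = "(a, c, b)"])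
  qed (auto simp: words_def)
  have inj: "inj_on (\<lambda>(a, c, b). [a, b, c]) ({..<q} \<times> {..<q} \<times> {..<q :: nat})"
    by (auto simp: inj_on_def)
  have "(\<Sum>y\<in>words q 3. weight y) = (\<Sum>a<q. \<Sum>c<q. \<Sum>b<q. weight [a, b, c])"
    unfolding eq sum.reindex[OF inj] by (simp add: sum.cartesian_product split_def o_def)
  also have "\<dots> = (\<Sum>a<q. \<Sum>c<q. if a = c then 4 else q + 2)"
    by (intro sum.cong sum_weight_middle) auto
  also have "\<dots> = (\<Sum>a<q. 4 + (q - 1) * (q + 2))"
  proof (intro sum.cong refl)
    fix a assume a: "a \<in> {..<q}"
    have "(\<Sum>c<q. if a = c then 4 else q + 2) = 4 + (\<Sum>c\<in>{..<q} - {a}. if a = c then 4 else q + 2)"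
      using a by (subst sum.remove[of _ a]) auto
    also have "(\<Sum>c\<in>{..<q} - {a}. if a = c then 4 else q + 2) = (\<Sum>c\<in>{..<q} - {a}. q + 2)"
      by (intro sum.cong) auto
    finally show "(\<Sum>c<q. if a = c then 4 else q + 2) = 4 + (q - 1) * (q + 2)"
      using a by simp
  qed
  finally show ?thesis by (simp add: algebra_simps)
qed

lemma corrects_disjoint:
  assumes "corrects_single_deletion C" "x \<in> C" "y \<in> C" "z \<in> del1 x" "z \<in> del1 y"
  shows "x = y"
  using assms unfolding corrects_single_deletion_def by blast

text \<open>The code words \<open>abca\<close> for a fixed \<open>a\<close> give disjoint pairs \<open>{b, c}\<close>, since
  both \<open>aba\<close> and \<open>aca\<close> arise from \<open>abca\<close>.  For even \<open>q\<close> one letter is left over.\<close>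

lemma card_bracket_le:
  assumes C: "C \<subseteq> words q 4" "corrects_single_deletion C" and "even q"
  shows "2 * card {x \<in> C. bracket x} \<le> q * (q - 2)"
proof -
  define B where "B a = {x \<in> C. bracket x \<and> hd x = a}" for a
  have finC: "finite C" using C(1) finite_words finite_subset by blast
  have le: "2 * card (B a) \<le> q - 2" if a: "a < q" for a
  proof -
    define P where "P x = {x ! 1, x ! 2}" for x :: "nat list"
    have form: "\<exists>b c. x = [a, b, c, a] \<and> a \<noteq> b \<and> a \<noteq> c \<and> b \<noteq> c \<and> b < q \<and> c < q"
      if "x \<in> B a" for x
      using that C(1) unfolding B_def bracket_def by (fastforce simp: words_def)
    have two: "card (P x) = 2" if "x \<in> B a" for x
      using form[OF that] unfolding P_def by auto
    have "card (\<Union>x\<in>B a. P x) = (\<Sum>x\<in>B a. card (P x))"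
    proof (rule card_UN_disjoint)
      show "finite (B a)" unfolding B_def using finC by simp
      show "\<forall>x\<in>B a. finite (P x)" unfolding P_def by simp
      show "\<forall>x\<in>B a. \<forall>y\<in>B a. x \<noteq> y \<longrightarrow> P x \<inter> P y = {}"
      proof (intro ballI impI)
        fix x y assume xy: "x \<in> B a" "y \<in> B a" "x \<noteq> y"
        have del: "[a, b, a] \<in> del1 x" if "x \<in> B a" "b \<in> P x" for x b
          using form[OF that(1)] that(2) unfolding P_def by (auto simp: del1_four)
        have "x \<in> C" "y \<in> C" using xy unfolding B_def by auto
        thus "P x \<inter> P y = {}"
          using corrects_disjoint[OF C(2)] del xy by blast
      qed
    qed
    also have "\<dots> = 2 * card (B a)" using two by simp
    finally have eq: "card (\<Union>x\<in>B a. P x) = 2 * card (B a)" .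
    have "P x \<subseteq> {..<q} - {a}" if "x \<in> B a" for x
      using form[OF that] unfolding P_def by auto
    hence "(\<Union>x\<in>B a. P x) \<subseteq> {..<q} - {a}"
      by blast
    hence "card (\<Union>x\<in>B a. P x) \<le> card ({..<q} - {a})"
      by (intro card_mono) auto
    hence "2 * card (B a) \<le> q - 1" using eq a by simp
    thus ?thesis using \<open>even q\<close> a by presburger
  qed
  have "{x \<in> C. bracket x} = (\<Union>a<q. B a)"
    using C(1) unfolding B_def bracket_def by (fastforce simp: words_def)
  hence "card {x \<in> C. bracket x} \<le> (\<Sum>a<q. card (B a))"
    by (simp add: card_UN_le)
  hence "2 * card {x \<in> C. bracket x} \<le> (\<Sum>a<q. 2 * card (B a))"
    by (simp add: sum_distrib_left[symmetric])
  also have "\<dots> \<le> (\<Sum>a<q. q - 2)" using le by (intro sum_mono) auto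
  finally show ?thesis by simp
qed

text \<open>Disjoint deletion sets share no weight, so four times the size is at most the total
  weight of \<open>words q 3\<close> plus 2 for each \<open>bracket\<close> word.\<close>

lemma code_upper_bound:
  assumes C: "C \<subseteq> words q 4" "corrects_single_deletion C" and "even q" "q \<ge> 2"
  shows "4 * card C \<le> q\<^sup>2 * (q + 2)"
proof -
  have finC: "finite C" using C(1) finite_words finite_subset by blast
  have "4 * card C = (\<Sum>x\<in>C. 4)" by simp
  also have "\<dots> \<le> (\<Sum>x\<in>C. (\<Sum>y\<in>del1 x. weight y) + (if bracket x then 2 else 0))"
    using C(1) by (intro sum_mono weight_del1_ge) (auto simp: words_def)
  also have "\<dots> = (\<Sum>x\<in>C. \<Sum>y\<in>del1 x. weight y) + 2 * card {x \<in> C. bracket x}"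
    using finC by (simp add: sum.distrib sum.inter_filter[symmetric])
  also have "(\<Sum>x\<in>C. \<Sum>y\<in>del1 x. weight y) = (\<Sum>y\<in>(\<Union>x\<in>C. del1 x). weight y)"
    using C(2) finC finite_del1 unfolding corrects_single_deletion_def
    by (intro sum.UNION_disjoint[symmetric]) auto
  also have "\<dots> \<le> (\<Sum>y\<in>words q 3. weight y)"
    using C(1) del1_words[of _ q 3] by (intro sum_mono2 finite_words) auto
  finally have "4 * card C \<le> (4 * q + q * (q - 1) * (q + 2)) + q * (q - 2)"
    unfolding sum_weight_words using card_bracket_le[OF C \<open>even q\<close>] by linarith
  also have "\<dots> = q\<^sup>2 * (q + 2)"
  proof -
    \<comment> \<open>This form of \<open>q\<close> removes the truncated subtractions.\<close>
    obtain k where "q = k + 2" using \<open>q \<ge> 2\<close> le_Suc_ex by (metis add.commute)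
    thus ?thesis by (simp add: power2_eq_square algebra_simps)
  qed
  finally show ?thesis .
qed

section \<open>The construction\<close>

definition cyc :: "int \<Rightarrow> int list \<Rightarrow> nat list" where
  "cyc n ks = map (\<lambda>k. nat (k mod n)) ks"

text \<open>The range \<open>b\<close> of shifts is separate from the modulus: for
  \<open>n = 2 * h\<close>, the choices \<open>h\<close> and \<open>h div 2\<close> give one shift
  for each coset of the subgroup of order two or four.\<close>

definition translates :: "int \<Rightarrow> int \<Rightarrow> int list set \<Rightarrow> nat list set" where
  "translates n b S = (\<lambda>(p, ks). cyc n (map ((+) p) ks)) ` ({0..<b} \<times> S)"

lemma card_translates_le:
  assumes "finite S"
  shows "card (translates n b S) \<le> nat b * card S"
proof -
  have "card (translates n b S) \<le> card ({0..<b} \<times> S)"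
    unfolding translates_def using assms by (intro card_image_le) simp
  thus ?thesis by (simp add: card_cartesian_product)
qed

lemma finite_translates: "finite S \<Longrightarrow> finite (translates n b S)"
  unfolding translates_def by simp

lemma cyc_words:
  assumes "n > 0"
  shows "cyc n ks \<in> words (nat n) (length ks)"
  using assms unfolding cyc_def words_def by (auto simp: nat_less_iff)

lemma translates_words:
  assumes "n > 0" "\<And>ks. ks \<in> S \<Longrightarrow> length ks = l"
  shows "translates n b S \<subseteq> words (nat n) l"
proof
  fix w assume "w \<in> translates n b S"
  then obtain p ks where "ks \<in> S" "w = cyc n (map ((+) p) ks)"
    unfolding translates_def by auto
  thus "w \<in> words (nat n) l"
    using cyc_words[OF assms(1), of "map ((+) p) ks"] assms(2) by simp
qed

lemma cyc_eqI:
  assumes "list_all2 (\<lambda>j k. n dvd j - k) js ks"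
  shows "cyc n js = cyc n ks"
  using assms unfolding cyc_def
  by (induction rule: list_all2_induct) (auto simp: mod_eq_dvd_iff[symmetric])

text \<open>The shift \<open>p'\<close> is explicit here, as needed when not all shifts modulo
  \<open>n\<close> are available.\<close>

lemma cyc_mem_del1_translate:
  assumes "[k0, k1, k2, k3] \<in> S" "0 \<le> p'" "p' < b"
    and "[x, y, z] \<in> {[k1, k2, k3], [k0, k2, k3], [k0, k1, k3], [k0, k1, k2]}"
    and "n dvd p - (p' + x)" "n dvd p + u - (p' + y)" "n dvd p + u + v - (p' + z)"
  shows "\<exists>w\<in>translates n b S. cyc n [p, p + u, p + u + v] \<in> del1 w"
proof -
  have "cyc n [p, p + u, p + u + v] = cyc n [p' + x, p' + y, p' + z]"
    using assms(5-7) by (intro cyc_eqI) simp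
  also have "\<dots> \<in> del1 (cyc n (map ((+) p') [k0, k1, k2, k3]))"
    using assms(4) by (auto simp: cyc_def del1_four)
  finally show ?thesis
    using assms(1-3) unfolding translates_def by force
qed

text \<open>With all shifts available, \<open>(p - x) mod n\<close> aligns the first letters, so
  only the two differences have to agree. Their congruence is a choice among three values, which
  suits linear arithmetic.\<close>

lemma covered_by_translate:
  assumes "[k0, k1, k2, k3] \<in> S" "n > 0"
    and "[x, y, z] \<in> {[k1, k2, k3], [k0, k2, k3], [k0, k1, k3], [k0, k1, k2]}"
    and "y - x - u \<in> {- n, 0, n}" "z - y - v \<in> {- n, 0, n}"
  shows "\<exists>w\<in>translates n n S. cyc n [p, p + u, p + u + v] \<in> del1 w"
proof (rule cyc_mem_del1_translate[OF assms(1) _ _ assms(3)])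
  let ?p' = "(p - x) mod n"
  show "0 \<le> ?p'" "?p' < n" using \<open>n > 0\<close> by auto
  have p': "n dvd p - x - ?p'" by (simp add: dvd_minus_mod)
  have dvd: "n dvd k" if "k \<in> {- n, 0, n}" for k using that by auto
  note u = dvd[OF assms(4)] and v = dvd[OF assms(5)]
  show 1: "n dvd p - (?p' + x)" using p' by (simp add: algebra_simps)
  have "n dvd (p - (?p' + x)) - (y - x - u)" using 1 u by (rule dvd_diff)
  thus 2: "n dvd p + u - (?p' + y)" by (simp add: algebra_simps)
  have "n dvd (p + u - (?p' + y)) - (z - y - v)" using 2 v by (rule dvd_diff)
  thus "n dvd p + u + v - (?p' + z)" by (simp add: algebra_simps)
qed

section \<open>Base words and the differences they cover\<close>

definition skew :: "int \<Rightarrow> int list set" where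
  "skew h = {[0, s, t, s + t] | s t. (0 < t \<and> t < s \<and> s < h) \<or> (- h < s \<and> s < t \<and> t < 0)}"

text \<open>For \<open>b = s\<close> and \<open>b = - s\<close> these are
  \<open>0 b (b + h) 0\<close> and \<open>0 (b + h) b (2 * b)\<close>. The range of \<open>s\<close>
  takes one element from each set of differences \<open>s\<close>, \<open>- s\<close>,
  \<open>h - s\<close>, \<open>s - h\<close>; at \<open>2 * s = h\<close> deletions would
  collide.\<close>

definition cross :: "int \<Rightarrow> int list set" where
  "cross h = (\<Union>s\<in>{s. 0 < s \<and> 2 * s < h}.
     {[0, s, s + h, 0], [0, s + h, s, 2 * s], [0, - s, h - s, 0], [0, h - s, - s, - 2 * s]})"

text \<open>A perfect code for the words over \<open>{0, 1, 2, 3}\<close> that have no equal neighbours and are not of the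
  form \<open>j (j + 2) j\<close> modulo 4, found by computer search; it serves the cosets of the subgroup of order four.\<close>

definition quarter_words :: "nat list set" where
  "quarter_words = {[1,0,2,1], [3,0,2,3], [2,1,3,2], [0,1,3,0], [1,2,0,3], [0,3,1,2], [2,3,0,1], [3,2,1,0]}"

text \<open>Multiplication by \<open>h div 2\<close> carries the integers modulo 4 onto the subgroup
  of order four, which exists only for even \<open>h\<close>.\<close>

definition quarter :: "int \<Rightarrow> int list set" where
  "quarter h = (if even h then map (\<lambda>j. int j * (h div 2)) ` quarter_words else {})"

text \<open>The difference of larger absolute value serves as \<open>s\<close>; the other is
  \<open>t\<close> for equal signs and \<open>t - s\<close> for opposite signs. Its position decides
  which letter is deleted.\<close>

lemma skew_covers:
  assumes "-h < u" "u < h" "-h < v" "v < h" "u \<noteq> 0" "v \<noteq> 0" "u \<noteq> v" "u \<noteq> - v"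
  shows "\<exists>w\<in>translates (2 * h) (2 * h) (skew h). cyc (2 * h) [p, p + u, p + u + v] \<in> del1 w"
proof -
  have h: "0 < 2 * h" using assms by linarith
  have mem: "[0, s, t, s + t] \<in> skew h"
    if "(0 < t \<and> t < s \<and> s < h) \<or> (- h < s \<and> s < t \<and> t < 0)" for s t
    using that unfolding skew_def by blast
  consider "0 < v \<and> v < u \<or> u < v \<and> v < 0" | "0 < u \<and> u < v \<or> v < u \<and> u < 0"
    | "v < 0 \<and> - v < u \<or> 0 < v \<and> u < - v" | "u < 0 \<and> - u < v \<or> 0 < u \<and> v < - u"
    using assms by linarith
  thus ?thesis
  proof cases
    case 1
    hence "[0, u, v, u + v] \<in> skew h" using assms by (intro mem) auto
    from covered_by_translate[OF this h, of 0 u "u + v"] show ?thesis by simp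
  next
    case 2
    hence "[0, v, u, v + u] \<in> skew h" using assms by (intro mem) auto
    from covered_by_translate[OF this h, of 0 u "v + u"] show ?thesis by simp
  next
    case 3
    hence "[0, u, u + v, u + (u + v)] \<in> skew h" using assms by (intro mem) auto
    from covered_by_translate[OF this h, of 0 u "u + v"] show ?thesis by simp
  next
    case 4
    hence "[0, v, u + v, v + (u + v)] \<in> skew h" using assms by (intro mem) auto
    from covered_by_translate[OF this h, of v "u + v" "v + (u + v)"] show ?thesis by simp
  qed
qed

text \<open>Replacing \<open>w\<close> by its representative \<open>s\<close> below
  \<open>h / 2\<close> leaves four values of \<open>w\<close> for each of four patterns. These 16
  cases match the four deletions of the four base words one to one.\<close>

lemma cross_covers:
  assumes "-h < w" "w < h" "w \<noteq> 0" "2 * \<bar>w\<bar> \<noteq> h"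
    and uv: "(u, v) \<in> {(h, w), (w, h), (w, w), (w, - w)}"
  shows "\<exists>x\<in>translates (2 * h) (2 * h) (cross h). cyc (2 * h) [p, p + u, p + u + v] \<in> del1 x"
proof -
  have h: "0 < 2 * h" using assms by linarith
  define s where "s = (if 2 * \<bar>w\<bar> < h then \<bar>w\<bar> else h - \<bar>w\<bar>)"
  have s: "0 < s" "2 * s < h" using assms unfolding s_def by auto
  have w: "w = s \<or> w = - s \<or> w = h - s \<or> w = s - h"
    unfolding s_def by auto
  have "[0, s, s + h, 0] \<in> cross h" "[0, s + h, s, 2 * s] \<in> cross h"
    "[0, - s, h - s, 0] \<in> cross h" "[0, h - s, - s, - 2 * s] \<in> cross h"
    unfolding cross_def using s by blast+
  note cov = this[THEN covered_by_translate, OF h]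
  from w uv consider
      "u = h" "v = s"
    | "u = h" "v = - s"
    | "u = h" "v = h - s"
    | "u = h" "v = s - h"
    | "u = s" "v = h"
    | "u = - s" "v = h"
    | "u = s - h" "v = h"
    | "u = h - s" "v = h"
    | "u = s" "v = s"
    | "u = - s" "v = - s"
    | "u = s - h" "v = s - h"
    | "u = h - s" "v = h - s"
    | "u = s" "v = - s"
    | "u = - s" "v = s"
    | "u = s - h" "v = h - s"
    | "u = h - s" "v = s - h"
    by auto
  thus ?thesis
  proof cases
    case 1
    thus ?thesis by (intro cov(2)[of "s + h" s "2 * s"]) auto
  next
    case 2
    thus ?thesis by (intro cov(4)[of "h - s" "- s" "- 2 * s"]) auto
  next
    case 3
    thus ?thesis by (intro cov(1)[of s "s + h" 0]) auto
  next
    case 4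
    thus ?thesis by (intro cov(3)[of "- s" "h - s" 0]) auto
  next
    case 5
    thus ?thesis by (intro cov(1)[of 0 s "s + h"]) auto
  next
    case 6
    thus ?thesis by (intro cov(3)[of 0 "- s" "h - s"]) auto
  next
    case 7
    thus ?thesis by (intro cov(2)[of 0 "s + h" s]) auto
  next
    case 8
    thus ?thesis by (intro cov(4)[of 0 "h - s" "- s"]) auto
  next
    case 9
    thus ?thesis by (intro cov(2)[of 0 s "2 * s"]) auto
  next
    case 10
    thus ?thesis by (intro cov(4)[of 0 "- s" "- 2 * s"]) auto
  next
    case 11
    thus ?thesis by (intro cov(2)[of 0 "s + h" "2 * s"]) auto
  next
    case 12
    thus ?thesis by (intro cov(4)[of 0 "h - s" "- 2 * s"]) auto
  next
    case 13
    thus ?thesis by (intro cov(1)[of 0 s 0]) auto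
  next
    case 14
    thus ?thesis by (intro cov(3)[of 0 "- s" 0]) auto
  next
    case 15
    thus ?thesis by (intro cov(1)[of 0 "s + h" 0]) auto
  next
    case 16
    thus ?thesis by (intro cov(3)[of 0 "h - s" 0]) auto
  qed
qed

text \<open>The pairs \<open>(d, e)\<close> are the nonzero differences modulo 4 other than
  \<open>(2, 2)\<close>. With four first letters they give 32 words, which are checked one by
  one.\<close>

lemma quarter_words_cover:
  assumes "(d, e) \<in> {(2, 1), (2, -1), (1, 2), (-1, 2), (1, 1), (-1, -1), (1, -1), (-1, 1)}"
  shows "\<exists>w\<in>quarter_words.
    [nat (j mod 4), nat ((j + d) mod 4), nat ((j + d + e) mod 4)] \<in> del1 w"
proof -
  define k where "k = j mod 4"
  have k: "k = 0 \<or> k = 1 \<or> k = 2 \<or> k = 3" unfolding k_def by presburger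
  have "(j + d) mod 4 = (k + d) mod 4" "(j + d + e) mod 4 = (k + (d + e)) mod 4"
    unfolding k_def by (simp_all add: mod_add_left_eq add.assoc)
  moreover have "\<exists>w\<in>quarter_words.
      [nat k, nat ((k + d) mod 4), nat ((k + (d + e)) mod 4)] \<in> del1 w"
    using assms k unfolding insert_iff empty_iff prod.inject
    by (elim disjE conjE FalseE; simp add: quarter_words_def del1_four)
  ultimately show ?thesis unfolding k_def by simp
qed

lemma quarter_covers:
  assumes "0 < h" "2 * \<bar>w\<bar> = h"
    and uv: "(u, v) \<in> {(h, w), (w, h), (w, w), (w, - w)}"
  shows "\<exists>x\<in>translates (2 * h) (h div 2) (quarter h). cyc (2 * h) [p, p + u, p + u + v] \<in> del1 x"
proof -
  define s where "s = \<bar>w\<bar>"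
  have s: "0 < s" "h = 2 * s" "w = s \<or> w = - s" using assms unfolding s_def by auto
  \<comment> \<open>The letter \<open>p\<close> splits into a coset representative \<open>a\<close>
    and an index \<open>j\<close> within the coset; \<open>L\<close> maps indices modulo 4 to
    letters, as \<open>4 * s = 2 * h\<close>.\<close>
  define a where "a = p mod s"
  define j where "j = p div s"
  define L where "L i = nat ((a + int i * s) mod (4 * s))" for i
  have p: "p = a + j * s" unfolding a_def j_def by simp
  have L: "L (nat (k mod 4)) = nat ((a + k * s) mod (4 * s))" for k
  proof -
    have "4 * s dvd (k mod 4 - k) * s"
      by (intro mult_dvd_mono) (simp_all add: mod_eq_dvd_iff[symmetric])
    hence "4 * s dvd (a + (k mod 4) * s) - (a + k * s)"
      by (simp add: algebra_simps)
    hence "(a + (k mod 4) * s) mod (4 * s) = (a + k * s) mod (4 * s)"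
      by (simp only: mod_eq_dvd_iff)
    thus ?thesis unfolding L_def by simp
  qed
  obtain d e where de: "u = d * s" "v = e * s"
    "(d, e) \<in> {(2, 1), (2, -1), (1, 2), (-1, 2), (1, 1), (-1, -1), (1, -1), (-1, 1)}"
  proof -
    from s(3) obtain c where c: "w = c * s" "c \<in> {1, -1}" by force
    from uv show ?thesis
      using that[of 2 c] that[of c 2] that[of c c] that[of c "- c"] c s(2) by auto
  qed
  from quarter_words_cover[OF de(3), of j] obtain x where x: "x \<in> quarter_words"
    "[nat (j mod 4), nat ((j + d) mod 4), nat ((j + d + e) mod 4)] \<in> del1 x" by blast
  have "cyc (2 * h) [p, p + u, p + u + v] =
      map L [nat (j mod 4), nat ((j + d) mod 4), nat ((j + d + e) mod 4)]"
    unfolding cyc_def s(2) de(1,2) p by (simp add: L algebra_simps)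
  also have "\<dots> \<in> del1 (map L x)" unfolding del1_map using x(2) by (rule imageI)
  also have "map L x = cyc (2 * h) (map ((+) a) (map (\<lambda>i. int i * (h div 2)) x))"
    unfolding cyc_def L_def s(2) by simp
  finally have mem: "cyc (2 * h) [p, p + u, p + u + v] \<in>
      del1 (cyc (2 * h) (map ((+) a) (map (\<lambda>i. int i * (h div 2)) x)))" .
  have "map (\<lambda>i. int i * (h div 2)) x \<in> quarter h"
    using x(1) s(2) unfolding quarter_def by simp
  moreover have "a \<in> {0..<h div 2}" using s unfolding a_def by simp
  ultimately show ?thesis using mem unfolding translates_def by force
qed

text \<open>For \<open>x < h\<close> and \<open>y = x + h\<close>, the word \<open>xyxy\<close>
  yields \<open>xxy\<close>, \<open>xyy\<close>, \<open>xyx\<close> and \<open>yxy\<close>, while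
  \<open>yyxx\<close> yields the remaining \<open>yyx\<close> and \<open>yxx\<close>. Hence the case
  split on whether the first letter is below \<open>h\<close>.\<close>

lemma antipodal_covers:
  assumes "0 < h" "(u, v) \<in> {(0, h), (h, 0), (h, h)}"
  shows "\<exists>x\<in>translates (2 * h) h {[0, h, 0, h], [h, h, 0, 0]}.
    cyc (2 * h) [p, p + u, p + u + v] \<in> del1 x"
proof -
  define r where "r = p mod (2 * h)"
  have r: "0 \<le> r" "r < 2 * h" using assms(1) unfolding r_def by auto
  have d: "2 * h dvd k" if "k - (p - r) \<in> {- 2 * h, 0, 2 * h}" for k
  proof -
    have "2 * h dvd p - r" unfolding r_def by (rule dvd_minus_mod)
    moreover have "2 * h dvd k - (p - r)" using that by auto
    ultimately have "2 * h dvd (p - r) + (k - (p - r))" by (rule dvd_add)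
    thus ?thesis by simp
  qed
  let ?S = "{[0, h, 0, h], [h, h, 0, 0]}"
  have S: "[0, h, 0, h] \<in> ?S" "[h, h, 0, 0] \<in> ?S" by auto
  show ?thesis
  proof (cases "r < h")
    case True
    note cov = cyc_mem_del1_translate[OF S(1) r(1) True]
    from assms(2) consider "u = 0" "v = h" | "u = h" "v = 0" | "u = h" "v = h" by auto
    thus ?thesis
    proof cases
      case 1
      thus ?thesis by (intro cov[of 0 0 h]) (auto intro!: d)
    next
      case 2
      thus ?thesis by (intro cov[of 0 h h]) (auto intro!: d)
    next
      case 3
      thus ?thesis by (intro cov[of 0 h 0]) (auto intro!: d)
    qed
  next
    case False
    have "0 \<le> r - h" "r - h < h" using False r by auto
    note cov = cyc_mem_del1_translate[OF S(1) this] cyc_mem_del1_translate[OF S(2) this]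
    from assms(2) consider "u = 0" "v = h" | "u = h" "v = 0" | "u = h" "v = h" by auto
    thus ?thesis
    proof cases
      case 1
      thus ?thesis by (intro cov(2)[of h h 0]) (auto intro!: d)
    next
      case 2
      thus ?thesis by (intro cov(2)[of h 0 0]) (auto intro!: d)
    next
      case 3
      thus ?thesis by (intro cov(1)[of h 0 h]) (auto intro!: d)
    qed
  qed
qed

lemma double_covers:
  assumes "0 < h" "- h < d" "d < h" "d \<noteq> 0" "(u, v) \<in> {(0, d), (d, 0)}"
  shows "\<exists>x\<in>translates (2 * h) (2 * h) {[0, 0, d, d] | d. 0 < d \<and> d < 2 * h \<and> d \<noteq> h}.
    cyc (2 * h) [p, p + u, p + u + v] \<in> del1 x"
proof -
  \<comment> \<open>The base words use differences between 1 and \<open>2 * h - 1\<close>, so a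
    negative \<open>d\<close> is raised by the modulus.\<close>
  define c where "c = (if 0 < d then d else d + 2 * h)"
  have c: "c - d \<in> {- (2 * h), 0, 2 * h}" unfolding c_def by auto
  have "[0, 0, c, c] \<in> {[0, 0, d, d] | d. 0 < d \<and> d < 2 * h \<and> d \<noteq> h}"
    using assms unfolding c_def by auto
  note cov = covered_by_translate[OF this]
  from assms(5) consider "u = 0" "v = d" | "u = d" "v = 0" by auto
  thus ?thesis
  proof cases
    case 1
    thus ?thesis using c assms(1) by (intro cov[of "2 * h" 0 0 c]) auto
  next
    case 2
    thus ?thesis using c assms(1) by (intro cov[of "2 * h" 0 c c]) auto
  qed
qed

section \<open>The code and its covering property\<close>

definition constants :: "int \<Rightarrow> nat list set" where
  "constants h = translates (2 * h) (2 * h) {[0, 0, 0, 0]}"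

definition two_runs :: "int \<Rightarrow> nat list set" where
  "two_runs h = translates (2 * h) (2 * h) {[0, 0, d, d] | d. 0 < d \<and> d < 2 * h \<and> d \<noteq> h}
     \<union> translates (2 * h) h {[h, h, 0, 0]}"

definition four_runs :: "int \<Rightarrow> nat list set" where
  "four_runs h = translates (2 * h) h {[0, h, 0, h]}
     \<union> translates (2 * h) (2 * h) (skew h)
     \<union> translates (2 * h) (2 * h) (cross h)
     \<union> translates (2 * h) (h div 2) (quarter h)"

text \<open>The grouping is by the number of runs, since a word has as many distinct deletions as
  runs.\<close>

definition code :: "int \<Rightarrow> nat list set" where
  "code h = constants h \<union> two_runs h \<union> four_runs h"

lemma code_covers_difference:
  assumes h: "0 < h" and u: "- h < u" "u \<le> h" and v: "- h < v" "v \<le> h"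
  shows "\<exists>x\<in>code h. cyc (2 * h) [p, p + u, p + u + v] \<in> del1 x"
proof -
  have covI: ?thesis
    if "\<exists>x\<in>T. cyc (2 * h) [p, p + u, p + u + v] \<in> del1 x" "T \<subseteq> code h" for T
    using that by blast
  have anti: "translates (2 * h) h {[0, h, 0, h], [h, h, 0, 0]} \<subseteq> code h"
    unfolding code_def two_runs_def four_runs_def translates_def by auto
  \<comment> \<open>All four patterns reduce to one difference \<open>w\<close> outside
    \<open>{0, h}\<close>; whether \<open>w\<close> has order four decides between
    \<open>quarter\<close> and \<open>cross\<close>.\<close>
  have cq: ?thesis
    if "(u, v) \<in> {(h, w), (w, h), (w, w), (w, - w)}" "- h < w" "w < h" "w \<noteq> 0" for w
  proof (cases "2 * \<bar>w\<bar> = h")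
    case True
    show ?thesis
      by (rule covI[OF quarter_covers[OF h True that(1)]]) (auto simp: code_def four_runs_def)
  next
    case False
    show ?thesis
      by (rule covI[OF cross_covers[OF that(2-4) False that(1)]]) (auto simp: code_def four_runs_def)
  qed
  consider (const) "u = 0" "v = 0"
    | (antipodal) "u = 0 \<and> v = h \<or> u = h \<and> v = 0 \<or> u = h \<and> v = h"
    | (left) "u = 0" "v \<noteq> 0" "v \<noteq> h" | (right) "v = 0" "u \<noteq> 0" "u \<noteq> h"
    | (cross_left) "u = h" "v \<noteq> 0" "v \<noteq> h" | (cross_right) "v = h" "u \<noteq> 0" "u \<noteq> h"
    | (equal) "v = u \<or> v = - u" "u \<noteq> 0" "u \<noteq> h"
    | (skew) "u \<noteq> 0" "v \<noteq> 0" "u \<noteq> h" "v \<noteq> h" "v \<noteq> u" "v \<noteq> - u"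
    by blast
  thus ?thesis
  proof cases
    case const
    have "\<exists>x\<in>constants h. cyc (2 * h) [p, p + u, p + u + v] \<in> del1 x"
      unfolding constants_def using h const
      by (intro covered_by_translate[of 0 0 0 0 _ _ 0 0 0]) auto
    thus ?thesis unfolding code_def by blast
  next
    case antipodal
    hence "(u, v) \<in> {(0, h), (h, 0), (h, h)}" by auto
    thus ?thesis by (intro covI[OF antipodal_covers[OF h] anti])
  next
    case left
    thus ?thesis
      using h v by (intro covI[OF double_covers[of h v]]) (auto simp: code_def two_runs_def)
  next
    case right
    thus ?thesis
      using h u by (intro covI[OF double_covers[of h u]]) (auto simp: code_def two_runs_def)
  next
    case cross_left
    thus ?thesis using v by (intro cq[of v]) auto
  next
    case cross_right
    thus ?thesis using u by (intro cq[of u]) auto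
  next
    case equal
    thus ?thesis using u by (intro cq[of u]) auto
  next
    case skew
    hence "u \<noteq> v" "u \<noteq> - v" by auto
    with skew u v show ?thesis
      by (intro covI[OF skew_covers[of h u v p]]) (auto simp: code_def four_runs_def)
  qed
qed

lemma balanced_residue:
  assumes "0 < h"
  obtains u :: int where "- h < u" "u \<le> h" "2 * h dvd d - u"
proof -
  \<comment> \<open>The offset \<open>h - 1\<close> places the residue in the half-open interval
    that contains \<open>h\<close> but not \<open>- h\<close>.\<close>
  define u where "u = (d + h - 1) mod (2 * h) - (h - 1)"
  have "0 \<le> (d + h - 1) mod (2 * h)" "(d + h - 1) mod (2 * h) < 2 * h" using assms by auto
  moreover have "2 * h dvd (d + h - 1) - (d + h - 1) mod (2 * h)" by (rule dvd_minus_mod)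
  ultimately show ?thesis using that[of u] unfolding u_def by (simp add: algebra_simps)
qed

lemma code_covers:
  assumes h: "0 < h" and y: "y \<in> words (nat (2 * h)) 3"
  shows "\<exists>x\<in>code h. y \<in> del1 x"
proof -
  from y obtain a b c where abc: "y = [a, b, c]" "a < nat (2 * h)" "b < nat (2 * h)" "c < nat (2 * h)"
    by (rule words_threeE)
  obtain u where u: "- h < u" "u \<le> h" "2 * h dvd (int b - int a) - u"
    by (rule balanced_residue[OF h])
  obtain v where v: "- h < v" "v \<le> h" "2 * h dvd (int c - int b) - v"
    by (rule balanced_residue[OF h])
  have "2 * h dvd ((int b - int a) - u) + ((int c - int b) - v)" using u(3) v(3) by (rule dvd_add)
  hence "2 * h dvd int c - (int a + u + v)" by (simp add: algebra_simps)
  moreover have "2 * h dvd int b - (int a + u)" using u(3) by (simp add: algebra_simps)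
  ultimately have "cyc (2 * h) [int a, int b, int c] = cyc (2 * h) [int a, int a + u, int a + u + v]"
    by (intro cyc_eqI) simp
  moreover have "cyc (2 * h) [int a, int b, int c] = y"
    using abc unfolding cyc_def by (simp add: zless_nat_conj nat_mod_distrib)
  ultimately show ?thesis using code_covers_difference[OF h u(1,2) v(1,2)] by metis
qed

section \<open>Counting\<close>

text \<open>Ordered pairs of distinct numbers in \<open>{1..<h}\<close> index both halves:
  \<open>t < s\<close> gives the positive base words, \<open>s < t\<close> the negated ones.\<close>

lemma skew_subset:
  "skew h \<subseteq> (\<lambda>(s, t). if t < s then [0, s, t, s + t] else [0, - t, - s, - t - s]) `
     (SIGMA s:{1..<h}. {1..<h} - {s})" (is "_ \<subseteq> ?f ` ?A")
proof
  fix ks assume "ks \<in> skew h"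
  then obtain s t where ks: "ks = [0, s, t, s + t]"
    and "(0 < t \<and> t < s \<and> s < h) \<or> (- h < s \<and> s < t \<and> t < 0)"
    unfolding skew_def by blast
  from this(2) show "ks \<in> ?f ` ?A"
  proof
    assume "0 < t \<and> t < s \<and> s < h"
    thus ?thesis using ks by (intro image_eqI[of _ _ "(s, t)"]) auto
  next
    assume "- h < s \<and> s < t \<and> t < 0"
    thus ?thesis using ks by (intro image_eqI[of _ _ "(- t, - s)"]) auto
  qed
qed

lemma finite_skew: "finite (skew h)"
  by (rule finite_subset[OF skew_subset]) auto

lemma card_skew_le: "card (skew h) \<le> nat (h - 1) * nat (h - 2)"
proof -
  have "card (skew h) \<le> card (SIGMA s:{1..<h}. {1..<h} - {s})"
    by (rule surj_card_le[OF _ skew_subset]) auto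
  also have "\<dots> = (\<Sum>s\<in>{1..<h}. nat (h - 2))"
    by (subst card_SigmaI) (auto intro!: sum.cong)
  finally show ?thesis by simp
qed

lemma cross_index: "{s :: int. 0 < s \<and> 2 * s < h} = {1..(h - 1) div 2}"
  by auto

lemma finite_cross: "finite (cross h)"
  unfolding cross_def cross_index by simp

lemma card_cross_le: "card (cross h) \<le> 4 * nat ((h - 1) div 2)"
proof -
  have "card (cross h) \<le> (\<Sum>s\<in>{1..(h - 1) div 2}. 4)"
    unfolding cross_def cross_index
    by (rule order.trans[OF card_UN_le]) (auto intro!: sum_mono simp: card_insert_if)
  thus ?thesis by simp
qed

lemma finite_quarter: "finite (quarter h)"
  unfolding quarter_def quarter_words_def by simp

lemma card_quarter_le: "card (quarter h) \<le> (if even h then 8 else 0)"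
proof -
  have "card (map (\<lambda>j. int j * (h div 2)) ` quarter_words) \<le> card quarter_words"
    by (rule card_image_le) (simp add: quarter_words_def)
  also have "card quarter_words \<le> 8" unfolding quarter_words_def by (simp add: card_insert_if)
  finally show ?thesis unfolding quarter_def by auto
qed

lemma doubles_subset:
  "{[0, 0, d, d] | d :: int. 0 < d \<and> d < 2 * h \<and> d \<noteq> h} \<subseteq> (\<lambda>d. [0, 0, d, d]) ` ({1..<2 * h} - {h})"
  by auto

lemma finite_doubles: "finite {[0, 0, d, d] | d :: int. 0 < d \<and> d < 2 * h \<and> d \<noteq> h}"
  by (rule finite_subset[OF doubles_subset]) simp

lemma card_doubles_le:
  assumes "0 < h"
  shows "card {[0, 0, d, d] | d :: int. 0 < d \<and> d < 2 * h \<and> d \<noteq> h} \<le> nat (2 * h - 2)"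
proof -
  have "card {[0, 0, d, d] | d :: int. 0 < d \<and> d < 2 * h \<and> d \<noteq> h} \<le> card ({1..<2 * h} - {h})"
    by (rule surj_card_le[OF _ doubles_subset]) simp
  thus ?thesis using assms by simp
qed

lemma finite_code: "finite (constants h)" "finite (two_runs h)" "finite (four_runs h)"
  unfolding constants_def two_runs_def four_runs_def
  by (simp_all add: finite_translates finite_skew finite_cross finite_quarter finite_doubles)

lemma card_constants_le: "card (constants (int k)) \<le> 2 * k"
  using card_translates_le[of "{[0, 0, 0, 0]}" "2 * int k" "2 * int k"]
  unfolding constants_def by (simp add: nat_mult_distrib)

lemma card_two_runs_le:
  assumes "0 < k"
  shows "card (two_runs (int k)) \<le> 2 * k * (2 * k - 2) + k"
proof -
  let ?D = "{[0, 0, d, d] | d :: int. 0 < d \<and> d < 2 * int k \<and> d \<noteq> int k}"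
  have "card (two_runs (int k)) \<le>
      card (translates (2 * int k) (2 * int k) ?D) + card (translates (2 * int k) (int k) {[int k, int k, 0, 0]})"
    unfolding two_runs_def by (rule card_Un_le)
  also have "\<dots> \<le> nat (2 * int k) * card ?D + nat (int k) * card {[int k, int k, 0, 0]}"
    by (intro add_mono card_translates_le finite_doubles) simp
  also have "\<dots> \<le> 2 * k * (2 * k - 2) + k"
  proof -
    have "card ?D \<le> 2 * k - 2" using card_doubles_le[of "int k"] assms by (simp add: nat_diff_distrib)
    thus ?thesis by (simp add: nat_mult_distrib)
  qed
  finally show ?thesis .
qed

text \<open>The rounding in \<open>(k - 1) div 2\<close> costs \<open>4 * k\<close> words for even
  \<open>k\<close>, exactly the number that \<open>quarter\<close> supplies, so both parities give
  the same total.\<close>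

lemma card_four_runs_le:
  assumes "0 < k"
  shows "card (four_runs (int k)) \<le> k + 2 * k * k * (k - 1)"
proof -
  let ?n = "2 * int k"
  have "card (four_runs (int k)) \<le>
      card (translates ?n (int k) {[0, int k, 0, int k]}) + card (translates ?n ?n (skew (int k)))
      + card (translates ?n ?n (cross (int k))) + card (translates ?n (int k div 2) (quarter (int k)))"
    unfolding four_runs_def by (intro order.trans[OF card_Un_le] add_mono order.refl)
  also have "\<dots> \<le> nat (int k) * card {[0, int k, 0, int k]} + nat ?n * card (skew (int k))
      + nat ?n * card (cross (int k)) + nat (int k div 2) * card (quarter (int k))"
    by (intro add_mono card_translates_le finite_skew finite_cross finite_quarter) simp
  also have "\<dots> \<le> k + 2 * k * ((k - 1) * (k - 2)) + 2 * k * (4 * ((k - 1) div 2))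
      + k div 2 * (if even k then 8 else 0)"
  proof (intro add_mono mult_mono)
    have "nat (int k - 1) = k - 1" "nat (int k - 2) = k - 2" by arith+
    thus "card (skew (int k)) \<le> (k - 1) * (k - 2)"
      using card_skew_le[of "int k"] by simp
    show "card (cross (int k)) \<le> 4 * ((k - 1) div 2)"
      using card_cross_le[of "int k"] assms by (simp add: nat_div_distrib nat_diff_distrib)
    show "card (quarter (int k)) \<le> (if even k then 8 else 0)"
      using card_quarter_le[of "int k"] by simp
  qed (auto simp: nat_mult_distrib nat_div_distrib)
  also have "\<dots> = k + 2 * k * k * (k - 1)"
  proof (cases "even k")
    case True
    with assms obtain j where "k = 2 * (j + 1)"
      by (metis add.commute dvdE gr0_conv_Suc mult_0_right neq0_conv plus_1_eq_Suc)
    thus ?thesis by (simp add: algebra_simps)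
  next
    case False
    then obtain j where "k = 2 * j + 1" by (elim oddE)
    \<comment> \<open>The case \<open>j = 0\<close> is \<open>k = 1\<close>, where
      \<open>k - 2\<close> is truncated.\<close>
    thus ?thesis by (cases j) (simp_all add: algebra_simps)
  qed
  finally show ?thesis .
qed

section \<open>From covering to disjointness\<close>

lemma card_del1_four_le: "card (del1 [a, b, c, d]) \<le> 4"
  using card_length[of "[[b, c, d], [a, c, d], [a, b, d], [a, b, c]]"]
  unfolding del1_four by simp

lemma card_del1_constants:
  assumes "x \<in> constants h"
  shows "card (del1 x) \<le> 1"
proof -
  obtain a where "x = [a, a, a, a]"
    using assms unfolding constants_def translates_def cyc_def by auto
  thus ?thesis by (simp add: del1_four)
qed

lemma card_del1_two_runs:
  assumes "x \<in> two_runs h"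
  shows "card (del1 x) \<le> 2"
proof -
  obtain a b where "x = [a, a, b, b]"
    using assms unfolding two_runs_def translates_def cyc_def by auto
  thus ?thesis by (simp add: del1_four card_insert_if)
qed

lemma code_words:
  assumes "0 < h"
  shows "code h \<subseteq> words (nat (2 * h)) 4"
proof -
  have skew: "length ks = 4" if "ks \<in> skew h" for ks
    using that unfolding skew_def by auto
  have cross: "length ks = 4" if "ks \<in> cross h" for ks
    using that unfolding cross_def by auto
  have "length w = 4" if "w \<in> quarter_words" for w
    using that unfolding quarter_words_def by auto
  hence quarter: "length ks = 4" if "ks \<in> quarter h" for ks
    using that unfolding quarter_def by (auto split: if_splits)
  have n: "0 < 2 * h" using assms by simp
  show ?thesis
    unfolding code_def constants_def two_runs_def four_runs_def
    by (intro Un_least translates_words[OF n]) (auto dest: skew cross quarter)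
qed

text \<open>If \<open>D x\<close> met \<open>D y\<close>, then \<open>D x - D y\<close> could
  replace \<open>D x\<close> without changing the union, making it smaller than the sum of the
  sizes.\<close>

lemma disjoint_if_sum_card_le:
  assumes "finite C" "\<And>x. x \<in> C \<Longrightarrow> finite (D x)" "(\<Sum>x\<in>C. card (D x)) \<le> card (\<Union>x\<in>C. D x)"
    and "x \<in> C" "y \<in> C" "x \<noteq> y"
  shows "D x \<inter> D y = {}"
proof (rule ccontr)
  assume "D x \<inter> D y \<noteq> {}"
  hence "card (D x - D y) < card (D x)"
    using assms by (intro psubset_card_mono) auto
  moreover have "(\<Union>z\<in>C. D z) = (D x - D y) \<union> (\<Union>z\<in>C - {x}. D z)"
    using assms by auto
  hence "card (\<Union>z\<in>C. D z) \<le> card (D x - D y) + card (\<Union>z\<in>C - {x}. D z)"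
    by (metis card_Un_le)
  moreover have "card (\<Union>z\<in>C - {x}. D z) \<le> (\<Sum>z\<in>C - {x}. card (D z))"
    using assms(1) by (intro card_UN_le) simp
  moreover have "(\<Sum>z\<in>C. card (D z)) = card (D x) + (\<Sum>z\<in>C - {x}. card (D z))"
    using assms by (intro sum.remove) auto
  ultimately show False using assms(3) by linarith
qed

text \<open>The size bounds allow at most \<open>q ^ 3\<close> deletions in total, and all
  \<open>q ^ 3\<close> words are covered. Equality throughout yields both disjointness and the exact
  size of the code.\<close>

lemma code_perfect:
  assumes k: "0 < k"
  defines "q \<equiv> 2 * k"
  shows "code (int k) \<subseteq> words q 4" "corrects_single_deletion (code (int k))"
    "del1_set (code (int k)) = words q 3" "4 * card (code (int k)) = q\<^sup>2 * (q + 2)"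
proof -
  let ?C = "code (int k)"
  define A where "A = constants (int k)"
  \<comment> \<open>Set differences make the three classes disjoint by construction, so their sizes
    add up.\<close>
  define B where "B = two_runs (int k) - A"
  define F where "F = four_runs (int k) - (A \<union> two_runs (int k))"
  have q: "nat (2 * int k) = q" unfolding q_def by simp
  show sub: "?C \<subseteq> words q 4" using code_words[of "int k"] k q by simp
  have fin: "finite A" "finite B" "finite F"
    unfolding A_def B_def F_def using finite_code by auto
  have C: "?C = A \<union> B \<union> F" "A \<inter> B = {}" "(A \<union> B) \<inter> F = {}"
    unfolding code_def A_def B_def F_def by auto
  have finC: "finite ?C" using C(1) fin by simp
  show set: "del1_set ?C = words q 3"
  proof
    show "del1_set ?C \<subseteq> words q 3"
      using sub del1_words[of _ q 3] unfolding del1_set_def by auto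
    show "words q 3 \<subseteq> del1_set ?C"
      using code_covers[of "int k"] k unfolding del1_set_def q by auto
  qed
  have cov: "card (\<Union>x\<in>?C. del1 x) = q ^ 3"
    using set unfolding del1_set_def by (simp add: card_words)
  have S: "(\<Sum>x\<in>?C. card (del1 x)) \<le> card A + 2 * card B + 4 * card F"
  proof -
    have "(\<Sum>x\<in>?C. card (del1 x)) =
        (\<Sum>x\<in>A. card (del1 x)) + (\<Sum>x\<in>B. card (del1 x)) + (\<Sum>x\<in>F. card (del1 x))"
      unfolding C(1) using fin C by (simp add: sum.union_disjoint)
    also have "\<dots> \<le> (\<Sum>x\<in>A. 1) + (\<Sum>x\<in>B. 2) + (\<Sum>x\<in>F. 4)"
    proof (intro add_mono sum_mono)
      fix x assume "x \<in> F"
      hence "x \<in> words q 4" using sub C(1) by auto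
      thus "card (del1 x) \<le> 4" by (rule words_fourE) (simp add: card_del1_four_le)
    qed (auto simp: A_def B_def dest: card_del1_constants card_del1_two_runs)
    finally show ?thesis by simp
  qed
  have a: "card A \<le> 2 * k" unfolding A_def by (rule card_constants_le)
  have "card B \<le> card (two_runs (int k))"
    unfolding B_def using finite_code by (intro card_mono) auto
  hence b: "card B \<le> 2 * k * (2 * k - 2) + k" using card_two_runs_le[OF k] by linarith
  have "card F \<le> card (four_runs (int k))"
    unfolding F_def using finite_code by (intro card_mono) auto
  hence f: "card F \<le> k + 2 * k * k * (k - 1)" using card_four_runs_le[OF k] by linarith
  \<comment> \<open>Naming the nonlinear bounds leaves only linear reasoning about them.\<close>
  define b' where "b' = 2 * k * (2 * k - 2) + k"
  define f' where "f' = k + 2 * k * k * (k - 1)"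
  note b = b[folded b'_def] and f = f[folded f'_def]
  obtain j where j: "k = Suc j" using k gr0_conv_Suc by blast
  have tot: "2 * k + 2 * b' + 4 * f' = q ^ 3"
    unfolding q_def b'_def f'_def j by (simp add: power3_eq_cube algebra_simps)
  have lower: "q ^ 3 \<le> (\<Sum>x\<in>?C. card (del1 x))"
    unfolding cov[symmetric] using finC by (rule card_UN_le)
  have upper: "(\<Sum>x\<in>?C. card (del1 x)) \<le> card (\<Union>x\<in>?C. del1 x)"
    unfolding cov using S a b f tot by linarith
  show "corrects_single_deletion ?C"
    unfolding corrects_single_deletion_def
    by (intro ballI impI disjoint_if_sum_card_le[OF finC finite_del1 upper])
  have "card ?C = card A + card B + card F"
    unfolding C(1) using fin C by (simp add: card_Un_disjoint)
  moreover have "card A = 2 * k" "card B = b'" "card F = f'"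
    using S a b f tot lower by linarith+
  ultimately show "4 * card ?C = q\<^sup>2 * (q + 2)"
    unfolding q_def b'_def f'_def j by (simp add: power2_eq_square algebra_simps)
qed

theorem theorem5p1:
  fixes q :: nat
  assumes "even q" and "q \<ge> 2"
  shows "\<exists>C. C \<subseteq> words q 4 \<and> corrects_single_deletion C
            \<and> del1_set C = words q 3
            \<and> card C = N_del 4 q \<and> 4 * N_del 4 q = q^2 * (q + 2)"
proof -
  obtain k where q: "q = 2 * k" using \<open>even q\<close> by blast
  have "0 < k" using q \<open>q \<ge> 2\<close> by simp
  note code = code_perfect[OF this, folded q]
  have "N_del 4 q = card (code (int k))"
    unfolding N_del_def
  proof (rule Max_eqI)
    have "{card C | C. C \<subseteq> words q 4 \<and> corrects_single_deletion C} \<subseteq> card ` Pow (words q 4)"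
      by auto
    thus "finite {card C | C. C \<subseteq> words q 4 \<and> corrects_single_deletion C}"
      by (rule finite_subset) (simp add: finite_words)
    show "card (code (int k)) \<in> {card C | C. C \<subseteq> words q 4 \<and> corrects_single_deletion C}"
      using code by blast
    fix c assume "c \<in> {card C | C. C \<subseteq> words q 4 \<and> corrects_single_deletion C}"
    then obtain C where "c = card C" "C \<subseteq> words q 4" "corrects_single_deletion C" by blast
    thus "c \<le> card (code (int k))"
      using code_upper_bound[of C q] code(4) assms by linarith
  qed
  thus ?thesis using code by (intro exI[of _ "code (int k)"]) simp
qed

end
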